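(* Let $\mathbb{I}$ be any of $\mathbb{Z},\mathbb{Q},\mathbb{R}$ and $N\ge 1$; all matrices below are $2N\times 2N$ DBMs over $\overline{\mathbb{I}}=\mathbb{I}\cup\{+\infty\}$. 1. For all coherent $\mathbf{m}^+,\mathbf{n}^+$: $\mathcal{D}^+(\mathbf{m}^+\triangledown\mathbf{n}^+)\supseteq\mathcal{D}^+(\mathbf{m}^+)\cup\mathcal{D}^+(\mathbf{n}^+)$. 2. For every sequence $(\mathbf{n}^+_i)_{i\in\mathbb{N}}$ of coherent DBMs, the sequence $(\mathbf{m}^+_i)_{i\in\mathbb{N}}$ defined by induction by $$\mathbf{m}^+_0=(\mathbf{n}^+_0)^\bullet,\qquad \mathbf{m}^+_i=\mathbf{m}^+_{i-1}\triangledown\big((\mathbf{n}^+_i)^\bullet\big)\ \text{ for } i\ge 1,$$ is increasing (for $\trianglelefteq$), ultimately stationary, and its limit is greater than or equal to (for $\trianglelefteq$) $\bigvee_{i\in\mathbb{N}}(\mathbf{n}^+_i)^\bullet$.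
   Context: A Difference-Bound Matrix (DBM) is a square matrix with entries in $\overline{\mathbb{I}}=\mathbb{I}\cup\{+\infty\}$, indexed from $0$. The order $\trianglelefteq$ on DBMs of the same size is point-wise: $\mathbf{m}\trianglelefteq\mathbf{n}$ iff $\mathbf{m}_{ij}\le\mathbf{n}_{ij}$ for all $i,j$. $\bigvee_{i}$ is the point-wise supremum (computed in $\mathbb{R}\cup\{+\infty\}$), and being greater than or equal to it means being an upper bound of all members of the family. "Increasing" is in the weak sense. The widening operator is defined by $[\mathbf{m}^+\triangledown\mathbf{n}^+]_{ij}=\mathbf{m}^+_{ij}$ if $\mathbf{n}^+_{ij}\le\mathbf{m}^+_{ij}$, and $+\infty$ otherwise. For an index $i\in\{0,\ldots,2N-1\}$, $\bar{\imath}$ denotes $i\oplus 1$ (bitwise exclusive or), i.e. $\overline{2k}=2k+1$ and $\overline{2k+1}=2k$. A $2N\times 2N$ DBM $\mathbf{m}^+$ is coherent if $\mathbf{m}^+_{ij}=\mathbf{m}^+_{\bar{\jmath}\,\bar{\imath}}$ for all $i,j$. $\mathcal{D}(\mathbf{m}^+)=\{(s_0,\ldots,s_{2N-1})\in\mathbb{I}^{2N}\mid\forall i,j,\ s_j-s_i\le\mathbf{m}^+_{ij}\}$ and $\mathcal{D}^+(\mathbf{m}^+)=\{(s_0,\ldots,s_{N-1})\in\mathbb{I}^N\mid (s_0,-s_0,\ldots,s_{N-1},-s_{N-1})\in\mathcal{D}(\mathbf{m}^+)\}$. The strong closure $\mathbf{p}^\bullet$ of a coherent DBM $\mathbf{p}$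 is the output of the following algorithm: $\mathbf{p}_0=\mathbf{p}$, $\mathbf{p}_{k+1}=S^+(C^+_{2k}(\mathbf{p}_k))$ for $0\le k<N$, and $\mathbf{p}^\bullet=\mathbf{p}_N$, where $[C^+_k(\mathbf{n})]_{ii}=0$; for $i\ne j$, $$[C^+_k(\mathbf{n})]_{ij}=\min\big(\mathbf{n}_{ij},\ \mathbf{n}_{ik}+\mathbf{n}_{kj},\ \mathbf{n}_{i\bar{k}}+\mathbf{n}_{\bar{k}j},\ \mathbf{n}_{ik}+\mathbf{n}_{k\bar{k}}+\mathbf{n}_{\bar{k}j},\ \mathbf{n}_{i\bar{k}}+\mathbf{n}_{\bar{k}k}+\mathbf{n}_{kj}\big);$$ and $[S^+(\mathbf{n})]_{ij}=\min\big(\mathbf{n}_{ij},\ (\mathbf{n}_{i\bar{\imath}}+\mathbf{n}_{\bar{\jmath}j})/2\big)$ for all $i,j$. The division by 2 is taken as written, without rounding. *)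

theory Defs
  imports "Jordan_Normal_Form.Matrix" "HOL-Library.Extended_Real"
begin

text \<open>
  Matrix entries live in \<^typ>\<open>ereal\<close>, and a set \<open>I\<close> of reals stands for the integers, the rationals
  or the reals; membership in \<open>dbms I n\<close> excludes \<open>-\<infinity>\<close>. The order on DBMs is the point-wise
  order that the library already provides on \<^typ>\<open>ereal mat\<close>.
\<close>

definition dbms :: "real set \<Rightarrow> nat \<Rightarrow> ereal mat set" where
  "dbms I n = {m \<in> carrier_mat n n. elements_mat m \<subseteq> ereal ` I \<union> {\<infinity>}}"

definition bar :: "nat \<Rightarrow> nat" where
  "bar i = Bit_Operations.xor i 1"

lemma bar_even [simp]: "bar (2 * k) = 2 * k + 1"
  unfolding bar_def by (subst xor_one_eq) simp

lemma bar_odd [simp]: "bar (2 * k + 1) = 2 * k"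
  unfolding bar_def by (subst xor_one_eq) simp

lemma bar_less: "bar i < 2 * N \<longleftrightarrow> i < 2 * N"
  by (cases "even i") (auto elim!: evenE oddE simp del: One_nat_def add_Suc_right)

definition coherent :: "ereal mat \<Rightarrow> bool" where
  "coherent m \<longleftrightarrow>
    (\<forall>i < dim_row m. \<forall>j < dim_col m. m $$ (i, j) = m $$ (bar j, bar i))"

definition widen :: "ereal mat \<Rightarrow> ereal mat \<Rightarrow> ereal mat"  (infixl "\<nabla>" 65) where
  "m \<nabla> n = mat (dim_row m) (dim_col m)
    (\<lambda>(i, j). if n $$ (i, j) \<le> m $$ (i, j) then m $$ (i, j) else \<infinity>)"

definition potential_set :: "real set \<Rightarrow> ereal mat \<Rightarrow> real vec set" where
  "potential_set I m = {s \<in> carrier_vec (dim_row m). set\<^sub>v s \<subseteq> I \<and>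
    (\<forall>i < dim_row m. \<forall>j < dim_row m. ereal (s $ j - s $ i) \<le> m $$ (i, j))}"

text \<open>The vector \<open>(s\<^sub>0, -s\<^sub>0, s\<^sub>1, -s\<^sub>1, \<dots>)\<close>:\<close>

definition signed_double :: "real vec \<Rightarrow> real vec" where
  "signed_double s = vec (2 * dim_vec s)
    (\<lambda>i. if even i then s $ (i div 2) else - (s $ (i div 2)))"

definition octagon :: "real set \<Rightarrow> ereal mat \<Rightarrow> real vec set" where
  "octagon I m = {s \<in> carrier_vec (dim_row m div 2). set\<^sub>v s \<subseteq> I \<and>
    signed_double s \<in> potential_set I m}"

definition C_step :: "nat \<Rightarrow> ereal mat \<Rightarrow> ereal mat" where
  "C_step k n = mat (dim_row n) (dim_col n) (\<lambda>(i, j).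
    if i = j then 0
    else Min {n $$ (i, j),
              n $$ (i, k) + n $$ (k, j),
              n $$ (i, bar k) + n $$ (bar k, j),
              n $$ (i, k) + n $$ (k, bar k) + n $$ (bar k, j),
              n $$ (i, bar k) + n $$ (bar k, k) + n $$ (k, j)})"

definition S_step :: "ereal mat \<Rightarrow> ereal mat" where
  "S_step n = mat (dim_row n) (dim_col n) (\<lambda>(i, j).
    min (n $$ (i, j)) ((n $$ (i, bar i) + n $$ (bar j, j)) / 2))"

primrec closure_iter :: "ereal mat \<Rightarrow> nat \<Rightarrow> ereal mat" where
  "closure_iter p 0 = p"
| "closure_iter p (Suc k) = S_step (C_step (2 * k) (closure_iter p k))"

text \<open>
  The halving in \<^const>\<open>S_step\<close> is exact, so the strong closure of a DBM over the integers may have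
  non-integer entries.
\<close>

definition strong_closure :: "ereal mat \<Rightarrow> ereal mat"  ("_\<^sup>\<bullet>" [1000] 999) where
  "p\<^sup>\<bullet> = closure_iter p (dim_row p div 2)"

primrec widening_seq :: "(nat \<Rightarrow> ereal mat) \<Rightarrow> nat \<Rightarrow> ereal mat" where
  "widening_seq n 0 = (n 0)\<^sup>\<bullet>"
| "widening_seq n (Suc i) = widening_seq n i \<nabla> (n (Suc i))\<^sup>\<bullet>"

text \<open>
  For DBMs, which have no entry \<open>-\<infinity>\<close>, the supremum of a sequence in \<^typ>\<open>ereal\<close> is the
  supremum in \<open>\<real> \<union> {+\<infinity>}\<close>.
\<close>

definition dbm_SUP :: "nat \<Rightarrow> (nat \<Rightarrow> ereal mat) \<Rightarrow> ereal mat" where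
  "dbm_SUP d f = mat d d (\<lambda>(i, j). SUP k. f k $$ (i, j))"

lemma dbms_UNIV_iff:
  "m \<in> dbms UNIV n \<longleftrightarrow> m \<in> carrier_mat n n \<and> (\<forall>i<n. \<forall>j<n. m $$ (i, j) \<noteq> -\<infinity>)"
proof -
  have "range ereal \<union> {\<infinity>} = - {-\<infinity>}"
    by (auto simp: image_iff)
  then show ?thesis
    unfolding dbms_def by (auto simp: subset_iff dest!: elements_matD)
qed

lemma C_step_dbms:
  assumes "n \<in> dbms UNIV (2 * N)" "k < 2 * N"
  shows "C_step k n \<in> dbms UNIV (2 * N)"
proof -
  have Min5: "Min {a, b, c, d, e} = min a (min b (min c (min d e)))" for a b c d e :: ereal
    by (simp add: min.assoc)
  show ?thesis
    using assms unfolding dbms_UNIV_iff C_step_def Min5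
    by (auto simp: bar_less ereal_plus_eq_MInfty min_def split: if_splits)
qed

lemma S_step_dbms:
  assumes "n \<in> dbms UNIV (2 * N)"
  shows "S_step n \<in> dbms UNIV (2 * N)"
proof -
  have half: "x / 2 \<noteq> -\<infinity>" if "x \<noteq> -\<infinity>" for x :: ereal
    using that by (cases x) (auto simp: numeral_eq_ereal)
  have "min x (y / 2) \<noteq> -\<infinity>" if "x \<noteq> -\<infinity>" "y \<noteq> -\<infinity>" for x y :: ereal
    using that half unfolding min_def by auto
  with assms show ?thesis unfolding dbms_UNIV_iff S_step_def
    by (auto simp: bar_less ereal_plus_eq_MInfty)
qed

lemma strong_closure_dbms:
  assumes "p \<in> dbms I (2 * N)"
  shows "p\<^sup>\<bullet> \<in> dbms UNIV (2 * N)"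
proof -
  have p: "p \<in> dbms UNIV (2 * N)" and d: "dim_row p = 2 * N"
    using assms by (auto simp: dbms_def)
  have "k \<le> N \<Longrightarrow> closure_iter p k \<in> dbms UNIV (2 * N)" for k
    by (induction k) (auto simp: p intro!: S_step_dbms C_step_dbms)
  then show ?thesis by (simp add: strong_closure_def d)
qed

end

theory Submission
  imports Defs
begin

text \<open>Everything rests on \<open>widen_upper\<close>: the widening is an upper bound of both
  its arguments. Since octagons grow with their matrices, this gives the inclusion. Applied along
  the sequence, it makes each term lie above its predecessor and above the closure just absorbed.
  For termination, an entry can change at most once, by jumping to \<infinity>
  (\<open>widening_seq_entry\<close>); as a matrix has finitely many entries, the sequence is
  ultimately stationary, and its limit dominates every closure.\<close>

lemma widen_carrier [simp]: "m \<in> carrier_mat r c \<Longrightarrow> m \<nabla> n \<in> carrier_mat r c"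
  by (simp add: widen_def)

lemma widen_index:
  assumes "m \<in> carrier_mat r c" "i < r" "j < c"
  shows "(m \<nabla> n) $$ (i, j) = (if n $$ (i, j) \<le> m $$ (i, j) then m $$ (i, j) else \<infinity>)"
  using assms by (simp add: widen_def)

text \<open>An entry of \<open>m\<close> is kept only where it already dominates that of
  \<open>n\<close>; elsewhere the result is \<infinity>, which dominates both.\<close>

lemma widen_upper:
  assumes "m \<in> carrier_mat r c" "n \<in> carrier_mat r c"
  shows "m \<le> m \<nabla> n" "n \<le> m \<nabla> n"
  using assms by (auto simp: less_eq_mat_def widen_def)

text \<open>Larger entries weaken the constraints. Squareness matters because
  \<open>potential_set\<close> bounds both indices by \<open>dim_row\<close>, whereas the matrix
  order bounds column indices by \<open>dim_col\<close>.\<close>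

lemma potential_set_mono: "m \<le> n \<Longrightarrow> dim_row m = dim_col m \<Longrightarrow> potential_set I m \<subseteq> potential_set I n"
  unfolding potential_set_def less_eq_mat_def by (auto, meson order_trans)

lemma octagon_mono: "m \<le> n \<Longrightarrow> dim_row m = dim_col m \<Longrightarrow> octagon I m \<subseteq> octagon I n"
  using potential_set_mono unfolding octagon_def less_eq_mat_def by auto

lemma closure_iter_dim [simp]:
  "dim_row (closure_iter p k) = dim_row p" "dim_col (closure_iter p k) = dim_col p"
  by (induction k) (auto simp: S_step_def C_step_def)

lemma strong_closure_carrier [simp]: "p \<in> carrier_mat r c \<Longrightarrow> p\<^sup>\<bullet> \<in> carrier_mat r c"
  by (auto simp: strong_closure_def)

context
  fixes n :: "nat \<Rightarrow> ereal mat" and r c :: nat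
  assumes carrier: "\<And>k. n k \<in> carrier_mat r c"
begin

lemma widening_seq_carrier: "widening_seq n k \<in> carrier_mat r c"
  by (induction k) (simp_all add: carrier)

lemma mono_widening_seq: "mono (widening_seq n)"
  unfolding mono_iff_le_Suc
  using widen_upper(1)[OF widening_seq_carrier strong_closure_carrier[OF carrier]] by simp

lemma strong_closure_le_widening_seq: "(n k)\<^sup>\<bullet> \<le> widening_seq n k"
  using widen_upper(2)[OF widening_seq_carrier strong_closure_carrier[OF carrier]]
  by (cases k) simp_all

text \<open>Each step keeps an entry or replaces it by \<infinity>, and \<infinity> is kept forever,
  so no third value can appear.\<close>

lemma widening_seq_entry:
  assumes "i < r" "j < c"
  shows "widening_seq n k $$ (i, j) \<in> {widening_seq n 0 $$ (i, j), \<infinity>}"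
  using assms by (induction k) (auto simp: widen_index[OF widening_seq_carrier])

lemma widening_seq_stationary: "\<exists>L. \<forall>\<^sub>F k in sequentially. widening_seq n k = L"
proof -
  let ?w = "\<lambda>k p. widening_seq n k $$ p"
  have "\<exists>l. \<forall>\<^sub>F k in sequentially. ?w k p = l" if p: "p \<in> {..<r} \<times> {..<c}" for p
  proof (cases "\<exists>K. ?w K p = \<infinity>")
    case True
    then obtain K where K: "?w K p = \<infinity>" ..
    have "?w k p = \<infinity>" if "k \<ge> K" for k
    proof -
      \<comment> \<open>Monotonicity makes \<infinity> absorbing: once reached at \<open>K\<close>,
        it stays.\<close>
      have "?w K p \<le> ?w k p"
        using monoD[OF mono_widening_seq that] p
        by (auto simp: less_eq_mat_def carrier_matD[OF widening_seq_carrier])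
      with K show ?thesis by simp
    qed
    then show ?thesis
      unfolding eventually_sequentially by blast
  next
    case False
    \<comment> \<open>Of the two possible values, \<infinity> is excluded in this case.\<close>
    then have "?w k p = ?w 0 p" for k
      using widening_seq_entry[of "fst p" "snd p" k] p by auto
    then show ?thesis by (intro exI always_eventually allI)
  qed
  then obtain l where "\<And>p. p \<in> {..<r} \<times> {..<c} \<Longrightarrow> \<forall>\<^sub>F k in sequentially. ?w k p = l p"
    by metis
  \<comment> \<open>Finiteness of the index set merges the separate thresholds of the entries into a
    common one.\<close>
  then have "\<forall>\<^sub>F k in sequentially. \<forall>p\<in>{..<r} \<times> {..<c}. ?w k p = l p"
    by (intro eventually_ball_finite) auto
  then have "\<forall>\<^sub>F k in sequentially. widening_seq n k = mat r c l"
    by eventually_elim (auto intro!: eq_matI simp: carrier_matD[OF widening_seq_carrier])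
  then show ?thesis ..
qed

end

theorem theorem8:
  fixes I :: "real set" and N :: nat
  assumes "I \<in> {\<int>, \<rat>, \<real>}" and "N \<ge> 1"
  shows "(\<forall>m \<in> dbms I (2 * N). \<forall>n \<in> dbms I (2 * N). coherent m \<longrightarrow> coherent n \<longrightarrow>
            octagon I m \<union> octagon I n \<subseteq> octagon I (m \<nabla> n)) \<and>
         (\<forall>n :: nat \<Rightarrow> ereal mat. (\<forall>i. n i \<in> dbms I (2 * N) \<and> coherent (n i)) \<longrightarrow>
            mono (widening_seq n) \<and>
            (\<exists>L. (\<forall>\<^sub>F i in sequentially. widening_seq n i = L) \<and>
                 dbm_SUP (2 * N) (\<lambda>i. (n i)\<^sup>\<bullet>) \<le> L))"
proof (intro conjI ballI allI impI)
  fix m n assume "m \<in> dbms I (2 * N)" "n \<in> dbms I (2 * N)"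
  then have "m \<in> carrier_mat (2 * N) (2 * N)" "n \<in> carrier_mat (2 * N) (2 * N)"
    by (auto simp: dbms_def)
  then show "octagon I m \<union> octagon I n \<subseteq> octagon I (m \<nabla> n)"
    by (intro Un_least octagon_mono widen_upper) auto
next
  fix n :: "nat \<Rightarrow> ereal mat"
  assume n: "\<forall>i. n i \<in> dbms I (2 * N) \<and> coherent (n i)"
  have carrier: "n k \<in> carrier_mat (2 * N) (2 * N)" for k
    using n by (auto simp: dbms_def)
  note mono = mono_widening_seq[of n, OF carrier]
  show "mono (widening_seq n)" by (rule mono)
  obtain L where L: "\<forall>\<^sub>F k in sequentially. widening_seq n k = L"
    using widening_seq_stationary[of n, OF carrier] by blast
  then obtain K where K: "\<And>k. k \<ge> K \<Longrightarrow> widening_seq n k = L"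
    by (auto simp: eventually_sequentially)
  have upper: "(n k)\<^sup>\<bullet> \<le> L" for k
  proof -
    have "(n k)\<^sup>\<bullet> \<le> widening_seq n k"
      by (rule strong_closure_le_widening_seq[of n, OF carrier])
    \<comment> \<open>The index \<open>max k K\<close> is late enough both for monotonicity from
      \<open>k\<close> and for the sequence to have reached \<open>L\<close>.\<close>
    also have "\<dots> \<le> widening_seq n (max k K)"
      by (rule monoD[OF mono]) simp
    also have "\<dots> = L" by (rule K) simp
    finally show ?thesis .
  qed
  \<comment> \<open>The matrix order also demands equal dimensions; \<open>L\<close> inherits them
    from the term at \<open>K\<close>.\<close>
  have "L \<in> carrier_mat (2 * N) (2 * N)"
    using widening_seq_carrier[of n, OF carrier] K by (metis order_refl)
  with upper have "dbm_SUP (2 * N) (\<lambda>i. (n i)\<^sup>\<bullet>) \<le> L"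
    by (auto simp: less_eq_mat_def dbm_SUP_def intro!: SUP_least)
  with L show "\<exists>L. (\<forall>\<^sub>F i in sequentially. widening_seq n i = L) \<and>
                 dbm_SUP (2 * N) (\<lambda>i. (n i)\<^sup>\<bullet>) \<le> L" by blast
qed

end
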